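(* Let $F(x)=\mathbb{E}_{z\sim p(z;x)}[\tilde F(x;z)]$ be a general (possibly non-concave) function to be maximized over $\mathcal{C}$, let Assumptions (1)–(5) of the context hold, let $x^*$ be a maximizer of $F$ over $\mathcal{C}$, and let $\bar L^2=4B^2G^4+16G^4+4L^2+4B^2L^2$. Run SFW++ (non-concave version, described in the context) with $\eta_t=\epsilon/(\bar LD)$, $|\mathcal{M}_h^t|=2G/\epsilon$, $q=\lceil G/(16\epsilon)\rceil$, $|\mathcal{M}_0^t|=G^2/(8\epsilon^2)$ and $T=\bar L\,(F(x^* )-F(x^0))/\epsilon^2$ iterations. Assume that the target accuracy $\epsilon$ satisfies $\mathrm{mod}(T,q)=0$. Then the overall stochastic complexity is $$\sum_{i=0}^{T}|\mathcal{M}_h^i|+\sum_{k=0}^{T/q}|\mathcal{M}_0^{qk}|=O\!\left(\frac{\bar L\,G\,(F(x^* )-F(x^0))}{\epsilon^3}\right).$$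
   Context: Setting. $\mathcal{C}\subset\mathbb{R}^d$ is convex. For each $x$, $p(\cdot;x)$ is a probability distribution on a space $\mathcal{Z}$ (density $p(z;x)$), and $\tilde F:\mathbb{R}^d\times\mathcal{Z}\to\mathbb{R}$; $\tilde F(\cdot;z)$ and $\log p(z;\cdot)$ are twice differentiable. Norms are Euclidean for vectors and spectral for matrices; derivatives are with respect to the decision variable. Assumptions. (1) $\max_{z\in\mathcal{Z},x\in\mathcal{C}}\tilde F(x;z)\le B$. (2) $\mathcal{C}$ is compact with diameter $D$. (3) $\|\nabla\tilde F(x;z)\|\le G_{\tilde F}$ for all $z\in\mathcal{Z}$ and $\mathbb{E}_{z\sim p(z;x)}\|\nabla\log p(z;x)\|^4\le G_p^4$, for $x\in\mathcal{C}$; $G=\max\{G_{\tilde F},G_p\}$. (4) For all $x\in\mathcal{C}$: $\|\nabla^2\tilde F(x;z)\|\le L_{\tilde F}$ for all $z\in\mathcal{Z}$, and $\mathbb{E}_{z\sim p(z;x)}\|\nabla^2\log p(z;x)\|^2\le L_p^2$; $L=\max\{L_{\tilde F},L_p\}$. (5) For all $x,y\in\mathcal{C}$, $z\in\mathcal{Z}$: $\|\nabla^2\tilde F(x;z)-\nabla^2\tilde F(y;z)\|\le L_{2,\tilde F}\|x-y\|$ and $\|\nabla^2\log p(z;x)-\nabla^2\log p(z;y)\|\le L_{2,p}\|x-y\|$. Hessian estimator: $$\tilde\nabla^2F(y;z)=\tilde F(y;z)[\nabla\log p(z;y)][\nabla\log p(z;y)]^\top+[\nabla\tilde F(y;z)][\nabla\log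 p(z;y)]^\top+[\nabla\log p(z;y)][\nabla\tilde F(y;z)]^\top+\nabla^2\tilde F(y;z)+\tilde F(y;z)\nabla^2\log p(z;y).$$ Algorithm SFW++ (non-concave version), started at $x^0\in\mathcal{C}$. For $t=0,1,\dots,T$: if $t\equiv0\pmod q$, draw a minibatch $\mathcal{M}_0^t$ of samples $z\sim p(z;x^t)$ and set $g^t=\frac1{|\mathcal{M}_0^t|}\sum_{z\in\mathcal{M}_0^t}\nabla\tilde F(x^t;z)$. Otherwise draw a minibatch $\mathcal{M}_h^t$ of pairs $(a,z(a))$ ($a$ uniform on $[0,1]$, $z(a)\sim p(\cdot;x(a))$, $x(a)=ax^t+(1-a)x^{t-1}$), put $\tilde\nabla_t^2=\frac1{|\mathcal{M}_h^t|}\sum_{(a,z(a))\in\mathcal{M}_h^t}\tilde\nabla^2F(x(a);z(a))$ and $g^t=g^{t-1}+\tilde\nabla^2_t(x^t-x^{t-1})$. Then $v^t\in\arg\max_{v\in\mathcal{C}}\langle v,g^t\rangle$ and $x^{t+1}=x^t+\eta_t(v^t-x^t)$. The overall stochastic complexity counts the samples in the minibatches, as displayed in the claim. *)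

theory Defs
  imports "HOL-Probability.Probability"
begin

definition grad :: "(real^'n \<Rightarrow> real) \<Rightarrow> real^'n \<Rightarrow> real^'n" where
  "grad f x = (THE D. GDERIV f x :> D)"

definition hess :: "(real^'n \<Rightarrow> real) \<Rightarrow> real^'n \<Rightarrow> real^'n^'n" where
  "hess f x = matrix (frechet_derivative (grad f) (at x))"

definition twice_differentiable_on :: "(real^'n \<Rightarrow> real) \<Rightarrow> (real^'n) set \<Rightarrow> bool" where
  "twice_differentiable_on f X \<longleftrightarrow>
     (\<forall>x\<in>X. f differentiable (at x)) \<and> (\<forall>x\<in>X. grad f differentiable (at x))"

(* Not the library's norm on real^'n^'n, which is the Frobenius norm. *)
definition spectral_norm :: "real^'n^'n \<Rightarrow> real" where
  "spectral_norm A = onorm (\<lambda>v. A *v v)"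

definition outer_prod :: "real^'n \<Rightarrow> real^'n \<Rightarrow> real^'n^'n" where
  "outer_prod u w = (\<chi> i j. u $ i * w $ j)"

text \<open>The sample space is \<^term>\<open>space \<nu>\<close> for a reference measure \<^term>\<open>\<nu>\<close>;
  \<^term>\<open>p z x\<close> is the density at \<^term>\<open>z\<close> of the distribution with parameter \<^term>\<open>x\<close>,
  and \<^term>\<open>Ft x z\<close> is the stochastic objective.\<close>

definition law :: "'z measure \<Rightarrow> ('z \<Rightarrow> real^'n \<Rightarrow> real) \<Rightarrow> real^'n \<Rightarrow> 'z measure" where
  "law \<nu> p x = density \<nu> (\<lambda>z. ennreal (p z x))"

definition objective ::
  "'z measure \<Rightarrow> ('z \<Rightarrow> real^'n \<Rightarrow> real) \<Rightarrow> (real^'n \<Rightarrow> 'z \<Rightarrow> real) \<Rightarrow> real^'n \<Rightarrow> real" where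
  "objective \<nu> p Ft x = (\<integral>z. Ft x z \<partial>law \<nu> p x)"

definition score :: "('z \<Rightarrow> real^'n \<Rightarrow> real) \<Rightarrow> real^'n \<Rightarrow> 'z \<Rightarrow> real^'n" where
  "score p x z = grad (\<lambda>y. ln (p z y)) x"

definition score_hess :: "('z \<Rightarrow> real^'n \<Rightarrow> real) \<Rightarrow> real^'n \<Rightarrow> 'z \<Rightarrow> real^'n^'n" where
  "score_hess p x z = hess (\<lambda>y. ln (p z y)) x"

definition Ft_grad :: "(real^'n \<Rightarrow> 'z \<Rightarrow> real) \<Rightarrow> real^'n \<Rightarrow> 'z \<Rightarrow> real^'n" where
  "Ft_grad Ft x z = grad (\<lambda>y. Ft y z) x"

definition Ft_hess :: "(real^'n \<Rightarrow> 'z \<Rightarrow> real) \<Rightarrow> real^'n \<Rightarrow> 'z \<Rightarrow> real^'n^'n" where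
  "Ft_hess Ft x z = hess (\<lambda>y. Ft y z) x"

text \<open>The densities and the derivatives only have to make sense on an open set \<^term>\<open>X\<close>
  containing the feasible set (\<^term>\<open>X = UNIV\<close> is allowed), so that families of distributions
  which are parametrized by a proper subset of the Euclidean space are covered.\<close>

definition sfw_setting ::
  "'z measure \<Rightarrow> ('z \<Rightarrow> real^'n \<Rightarrow> real) \<Rightarrow> (real^'n \<Rightarrow> 'z \<Rightarrow> real) \<Rightarrow>
   (real^'n) set \<Rightarrow> (real^'n) set \<Rightarrow> bool" where
  "sfw_setting \<nu> p Ft X C \<longleftrightarrow>
     sigma_finite_measure \<nu> \<and> convex C \<and> open X \<and> C \<subseteq> X \<and>
     (\<forall>x\<in>X. (\<lambda>z. p z x) \<in> borel_measurable \<nu> \<and> (\<forall>z\<in>space \<nu>. 0 < p z x) \<and>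
            prob_space (law \<nu> p x)) \<and>
     (\<forall>x\<in>X. Ft x \<in> borel_measurable \<nu>) \<and>
     (\<forall>x\<in>C. integrable (law \<nu> p x) (Ft x)) \<and>
     (\<forall>z\<in>space \<nu>. twice_differentiable_on (\<lambda>x. Ft x z) X \<and>
                   twice_differentiable_on (\<lambda>x. ln (p z x)) X)"

definition sfw_assumptions ::
  "'z measure \<Rightarrow> ('z \<Rightarrow> real^'n \<Rightarrow> real) \<Rightarrow> (real^'n \<Rightarrow> 'z \<Rightarrow> real) \<Rightarrow> (real^'n) set \<Rightarrow>
   real \<Rightarrow> real \<Rightarrow> real \<Rightarrow> real \<Rightarrow> real \<Rightarrow> real \<Rightarrow> real \<Rightarrow> real \<Rightarrow> bool" where
  "sfw_assumptions \<nu> p Ft C B D GF Gp LF Lp L2F L2p \<longleftrightarrow>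
     0 \<le> Gp \<and> 0 \<le> Lp \<and>
     (\<forall>x\<in>C. \<forall>z\<in>space \<nu>. Ft x z \<le> B) \<and>
     compact C \<and> diameter C = D \<and>
     (\<forall>x\<in>C. \<forall>z\<in>space \<nu>. norm (Ft_grad Ft x z) \<le> GF) \<and>
     (\<forall>x\<in>C. integrable (law \<nu> p x) (\<lambda>z. norm (score p x z) ^ 4) \<and>
            (\<integral>z. norm (score p x z) ^ 4 \<partial>law \<nu> p x) \<le> Gp ^ 4) \<and>
     (\<forall>x\<in>C. \<forall>z\<in>space \<nu>. spectral_norm (Ft_hess Ft x z) \<le> LF) \<and>
     (\<forall>x\<in>C. integrable (law \<nu> p x) (\<lambda>z. spectral_norm (score_hess p x z) ^ 2) \<and>
            (\<integral>z. spectral_norm (score_hess p x z) ^ 2 \<partial>law \<nu> p x) \<le> Lp ^ 2) \<and>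
     (\<forall>x\<in>C. \<forall>y\<in>C. \<forall>z\<in>space \<nu>.
        spectral_norm (Ft_hess Ft x z - Ft_hess Ft y z) \<le> L2F * norm (x - y) \<and>
        spectral_norm (score_hess p x z - score_hess p y z) \<le> L2p * norm (x - y))"

definition hess_estimator ::
  "('z \<Rightarrow> real^'n \<Rightarrow> real) \<Rightarrow> (real^'n \<Rightarrow> 'z \<Rightarrow> real) \<Rightarrow> real^'n \<Rightarrow> 'z \<Rightarrow> real^'n^'n" where
  "hess_estimator p Ft y z =
     Ft y z *\<^sub>R outer_prod (score p y z) (score p y z)
     + outer_prod (Ft_grad Ft y z) (score p y z)
     + outer_prod (score p y z) (Ft_grad Ft y z)
     + Ft_hess Ft y z
     + Ft y z *\<^sub>R score_hess p y z"

definition sample_mean :: "('s \<Rightarrow> 'v::real_vector) \<Rightarrow> 's list \<Rightarrow> 'v" where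
  "sample_mean f zs = (1 / real (length zs)) *\<^sub>R (\<Sum>z\<leftarrow>zs. f z)"

text \<open>Joint law of a pair \<open>(a, z(a))\<close> with \<open>a\<close> uniform on the unit interval and
  \<open>z(a)\<close> drawn from the distribution with parameter \<open>a u + (1 - a) w\<close>.\<close>

definition segment_law ::
  "'z measure \<Rightarrow> ('z \<Rightarrow> real^'n \<Rightarrow> real) \<Rightarrow> real^'n \<Rightarrow> real^'n \<Rightarrow> (real \<times> 'z) measure" where
  "segment_law \<nu> p u w =
     density (lborel \<Otimes>\<^sub>M \<nu>)
       (\<lambda>(a, z). indicator {0..1} a * ennreal (p z (a *\<^sub>R u + (1 - a) *\<^sub>R w)))"

text \<open>Conditionally on the sub-sigma-algebra \<^term>\<open>H\<close>, the entries of the random list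
  \<^term>\<open>S\<close> of length \<^term>\<open>m\<close> are independent with (random) distribution \<^term>\<open>K\<close>.\<close>

definition minibatch_given ::
  "'w measure \<Rightarrow> 'w measure \<Rightarrow> nat \<Rightarrow> 's measure \<Rightarrow> ('w \<Rightarrow> 's measure) \<Rightarrow> ('w \<Rightarrow> 's list) \<Rightarrow> bool"
where
  "minibatch_given \<Omega> H m N K S \<longleftrightarrow>
     (\<forall>A\<in>sets H. \<forall>B. (\<forall>j<m. B j \<in> sets N) \<longrightarrow>
        emeasure \<Omega> {\<omega>\<in>A. \<forall>j<m. S \<omega> ! j \<in> B j} =
        (\<integral>\<^sup>+\<omega>\<in>A. (\<Prod>j<m. emeasure (K \<omega>) (B j)) \<partial>\<Omega>))"

text \<open>A run is a family of stochastic processes on a probability space \<^term>\<open>\<Omega>\<close>; \<^term>\<open>H t\<close> is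
  the information available before the samples of step \<^term>\<open>t\<close> are drawn. Every \<^term>\<open>Mh t\<close>
  has the prescribed length, also at the steps \<^prop>\<open>t mod q = 0\<close>, where the
  algorithm does not use it: the complexity count runs over all steps.\<close>

definition sfwpp_run ::
  "'z measure \<Rightarrow> ('z \<Rightarrow> real^'n \<Rightarrow> real) \<Rightarrow> (real^'n \<Rightarrow> 'z \<Rightarrow> real) \<Rightarrow> (real^'n) set \<Rightarrow> real^'n \<Rightarrow>
   (nat \<Rightarrow> real) \<Rightarrow> nat \<Rightarrow> nat \<Rightarrow> nat \<Rightarrow> nat \<Rightarrow>
   'w measure \<Rightarrow> (nat \<Rightarrow> 'w measure) \<Rightarrow>
   (nat \<Rightarrow> 'w \<Rightarrow> real^'n) \<Rightarrow> (nat \<Rightarrow> 'w \<Rightarrow> real^'n) \<Rightarrow> (nat \<Rightarrow> 'w \<Rightarrow> real^'n) \<Rightarrow>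
   (nat \<Rightarrow> 'w \<Rightarrow> 'z list) \<Rightarrow> (nat \<Rightarrow> 'w \<Rightarrow> (real \<times> 'z) list) \<Rightarrow> bool" where
  "sfwpp_run \<nu> p Ft C x0 \<eta> mh m0 q T \<Omega> H x v g M0 Mh \<longleftrightarrow>
     prob_space \<Omega> \<and> filtration (space \<Omega>) H \<and> (\<forall>t. subalgebra \<Omega> (H t)) \<and>
     (\<forall>\<omega>\<in>space \<Omega>. x 0 \<omega> = x0) \<and>
     (\<forall>t\<le>T.
        x t \<in> borel_measurable (H t) \<and>
        g t \<in> borel_measurable (H (Suc t)) \<and>
        v t \<in> borel_measurable (H (Suc t)) \<and>
        (\<forall>\<omega>\<in>space \<Omega>. length (Mh t \<omega>) = mh) \<and>
        (if t mod q = 0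
         then (\<forall>\<omega>\<in>space \<Omega>. length (M0 t \<omega>) = m0) \<and>
              (\<forall>j<m0. (\<lambda>\<omega>. M0 t \<omega> ! j) \<in> measurable (H (Suc t)) \<nu>) \<and>
              minibatch_given \<Omega> (H t) m0 \<nu> (\<lambda>\<omega>. law \<nu> p (x t \<omega>)) (M0 t) \<and>
              (\<forall>\<omega>\<in>space \<Omega>. g t \<omega> = sample_mean (Ft_grad Ft (x t \<omega>)) (M0 t \<omega>))
         else (\<forall>j<mh. (\<lambda>\<omega>. Mh t \<omega> ! j) \<in> measurable (H (Suc t)) (borel \<Otimes>\<^sub>M \<nu>)) \<and>
              minibatch_given \<Omega> (H t) mh (borel \<Otimes>\<^sub>M \<nu>)
                (\<lambda>\<omega>. segment_law \<nu> p (x t \<omega>) (x (t - 1) \<omega>)) (Mh t) \<and>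
              (\<forall>\<omega>\<in>space \<Omega>.
                 g t \<omega> = g (t - 1) \<omega> +
                   sample_mean (\<lambda>(a, z). hess_estimator p Ft
                                  (a *\<^sub>R x t \<omega> + (1 - a) *\<^sub>R x (t - 1) \<omega>) z) (Mh t \<omega>)
                   *v (x t \<omega> - x (t - 1) \<omega>))) \<and>
        (\<forall>\<omega>\<in>space \<Omega>.
           is_arg_max (\<lambda>u. u \<bullet> g t \<omega>) (\<lambda>u. u \<in> C) (v t \<omega>) \<and>
           x (Suc t) \<omega> = x t \<omega> + \<eta> t *\<^sub>R (v t \<omega> - x t \<omega>)))"

end

theory Submission
  imports Defs
begin

text \<open>Along every run the minibatch lengths are prescribed, so the count is exactly
  \<open>(T + 1) |M\<^sub>h| + (T / q + 1) |M\<^sub>0|\<close>. Write \<open>A\<close> for \<open>\<bar>L (F(x\<^sup>*) - F(x\<^sup>0))\<close>. For small \<open>\<epsilon>\<close> the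
  roundings and the two extra terms are absorbed into the leading ones, and each product is of
  order \<open>A G / \<epsilon>\<^sup>3\<close>, since \<open>T / q\<close> is of order \<open>A / (G \<epsilon>)\<close>. If \<open>G = 0\<close> all
  minibatches are empty; if \<open>G > 0\<close> then \<open>\<bar>L > 0\<close>, because its radicand contains \<open>16 G\<^sup>4\<close>.\<close>

text \<open>A run fixes the length of \<open>M0 t\<close> only at steps with
  \<open>t mod q = 0\<close>, but the second sum visits just the indices \<open>q * k\<close>, which
  stay at most \<open>T\<close> because \<open>q * (T div q) <= T\<close>; this also covers
  \<open>q = 0\<close>. The closed ranges give the two extra ones.\<close>

lemma length_sum_sfwpp_run:
  assumes run: "sfwpp_run \<nu> p Ft C x0 \<eta> mh m0 q T \<Omega> H x v g M0 Mh" and "\<omega> \<in> space \<Omega>"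
  shows "(\<Sum>i=0..T. length (Mh i \<omega>)) + (\<Sum>k=0..T div q. length (M0 (q * k) \<omega>)) =
    (T + 1) * mh + (T div q + 1) * m0"
proof -
  have "length (Mh i \<omega>) = mh" if "i \<le> T" for i
    using run that assms(2) unfolding sfwpp_run_def by blast
  moreover have "length (M0 (q * k) \<omega>) = m0" if "k \<le> T div q" for k
  proof -
    have "q * k \<le> T"
      using that by (metis div_times_less_eq_dividend le_trans mult.commute mult_le_mono1)
    moreover have "(q * k) mod q = 0" by simp
    ultimately show ?thesis
      using run assms(2) by (simp add: sfwpp_run_def)
  qed
  ultimately show ?thesis by simp
qed

text \<open>The three smallness conditions say that \<open>G / \<epsilon>\<close>,
  \<open>A / \<epsilon>^2\<close> and \<open>A / (G * \<epsilon>)\<close> are at least 1. Hence each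
  1 lost to a ceiling or to a closed index range costs at most one more copy of the leading
  term.\<close>

lemma sample_count_le:
  fixes A G \<epsilon> :: real
  assumes pos: "0 < A" "0 < G" "0 < \<epsilon>"
    and small: "\<epsilon> \<le> G" "\<epsilon>^2 \<le> A" "\<epsilon> * G \<le> A"
    and T: "T = nat \<lceil>A / \<epsilon>^2\<rceil>" and q: "q = nat \<lceil>G / (16 * \<epsilon>)\<rceil>"
  shows "real ((T + 1) * nat \<lceil>2 * G / \<epsilon>\<rceil> + (T div q + 1) * nat \<lceil>G^2 / (8 * \<epsilon>^2)\<rceil>)
    \<le> 75 * (A * G / \<epsilon>^3)"
proof -
  have nat_le: "real (nat \<lceil>y\<rceil>) \<le> y + 1" if "0 < y" for y :: real
    using that by linarith
  have T1: "real T \<le> 2 * (A / \<epsilon>^2)"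
  proof -
    have "1 \<le> A / \<epsilon>^2" using pos small by (simp add: field_simps)
    then show ?thesis unfolding T using nat_le[of "A / \<epsilon>^2"] by linarith
  qed
  have T2: "real (T + 1) \<le> 3 * (A / \<epsilon>^2)"
  proof -
    have "1 \<le> A / \<epsilon>^2" using pos small by (simp add: field_simps)
    with T1 show ?thesis by simp
  qed
  have mh: "real (nat \<lceil>2 * G / \<epsilon>\<rceil>) \<le> 3 * (G / \<epsilon>)"
  proof -
    have "1 \<le> G / \<epsilon>" using pos small by (simp add: field_simps)
    moreover have "real (nat \<lceil>2 * G / \<epsilon>\<rceil>) \<le> 2 * (G / \<epsilon>) + 1"
      using pos nat_le[of "2 * (G / \<epsilon>)"] by simp
    ultimately show ?thesis by linarith
  qed
  have m0: "real (nat \<lceil>G^2 / (8 * \<epsilon>^2)\<rceil>) \<le> 2 * (G^2 / \<epsilon>^2)"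
  proof -
    have "1 \<le> G^2 / \<epsilon>^2" using pos small by (simp add: field_simps power_mono)
    moreover have "real (nat \<lceil>G^2 / (8 * \<epsilon>^2)\<rceil>) \<le> (G^2 / \<epsilon>^2) / 8 + 1"
      using pos nat_le[of "G^2 / (8 * \<epsilon>^2)"] by (simp add: mult.commute)
    ultimately show ?thesis by linarith
  qed
  have Tq: "real (T div q + 1) \<le> 33 * (A / (G * \<epsilon>))"
  proof -
    have "real (T div q) \<le> real T / real q" by (rule of_nat_div_le_of_nat)
    \<comment> \<open>\<open>q\<close> stands in the denominator, so rounding it up only lowers the
      quotient. The factor 32 is the 2 from \<open>T1\<close> times the 16 in
      \<open>q\<close>.\<close>
    also have "\<dots> \<le> real T / (G / (16 * \<epsilon>))"
      using pos unfolding q by (intro divide_left_mono) (auto intro!: mult_pos_pos)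
    also have "\<dots> \<le> 2 * (A / \<epsilon>^2) / (G / (16 * \<epsilon>))"
      using pos T1 by (intro divide_right_mono) auto
    also have "\<dots> = 32 * (A / (G * \<epsilon>))"
      using pos by (simp add: field_simps power2_eq_square)
    finally have "real (T div q) \<le> 32 * (A / (G * \<epsilon>))" .
    moreover have "1 \<le> A / (G * \<epsilon>)" using pos small by (simp add: field_simps)
    ultimately show ?thesis by simp
  qed
  \<comment> \<open>Both products are multiples of \<open>A * G / \<epsilon>^3\<close>, in the
    second after cancelling one \<open>G\<close>; the constant is 3 * 3 + 33 * 2 = 75.\<close>
  have "real ((T + 1) * nat \<lceil>2 * G / \<epsilon>\<rceil> + (T div q + 1) * nat \<lceil>G^2 / (8 * \<epsilon>^2)\<rceil>)
      \<le> 3 * (A / \<epsilon>^2) * (3 * (G / \<epsilon>)) + 33 * (A / (G * \<epsilon>)) * (2 * (G^2 / \<epsilon>^2))"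
    unfolding of_nat_add[of "_ * _"] of_nat_mult
    using pos by (intro add_mono mult_mono T2 mh Tq m0 of_nat_0_le_iff) auto
  also have "\<dots> = 75 * (A * G / \<epsilon>^3)"
    using pos by (simp add: field_simps power2_eq_square power3_eq_cube)
  finally show ?thesis .
qed

text \<open>Supplies the smallness conditions of \<open>sample_count_le\<close>, with
  \<open>a = 1\<close> and \<open>a = G\<close>.\<close>

lemma eventually_at_right_mult_le:
  fixes a c :: real
  assumes "0 < c"
  shows "\<forall>\<^sub>F \<epsilon> in at_right 0. \<epsilon> * a \<le> c"
proof -
  have "((\<lambda>\<epsilon>. \<epsilon> * a) \<longlongrightarrow> 0 * a) (at_right 0)" by (intro tendsto_intros)
  then have "\<forall>\<^sub>F \<epsilon> in at_right 0. \<epsilon> * a < c"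
    using assms by (intro order_tendstoD(2)[where y = "0 * a"]) auto
  then show ?thesis by (rule eventually_mono) simp
qed

theorem corollary3p5:
  shows "\<exists>K>0. \<forall>(\<nu> :: 'z measure) p (Ft :: real^'n \<Rightarrow> 'z \<Rightarrow> real) X C B D GF Gp LF Lp L2F L2p
           x0 xstar G L Lbar.
     sfw_setting \<nu> p Ft X C \<longrightarrow>
     sfw_assumptions \<nu> p Ft C B D GF Gp LF Lp L2F L2p \<longrightarrow>
     G = max GF Gp \<longrightarrow> L = max LF Lp \<longrightarrow>
     Lbar = sqrt (4 * B^2 * G^4 + 16 * G^4 + 4 * L^2 + 4 * B^2 * L^2) \<longrightarrow>
     is_arg_max (objective \<nu> p Ft) (\<lambda>x. x \<in> C) xstar \<longrightarrow>
     x0 \<in> C \<longrightarrow>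
     objective \<nu> p Ft x0 < objective \<nu> p Ft xstar \<longrightarrow>
     (\<forall>\<^sub>F \<epsilon> in at_right 0.
        \<forall>T q (\<Omega> :: 'w measure) H x v g M0 Mh.
          T = nat \<lceil>Lbar * (objective \<nu> p Ft xstar - objective \<nu> p Ft x0) / \<epsilon>^2\<rceil> \<longrightarrow>
          q = nat \<lceil>G / (16 * \<epsilon>)\<rceil> \<longrightarrow>
          T mod q = 0 \<longrightarrow>
          sfwpp_run \<nu> p Ft C x0 (\<lambda>t. \<epsilon> / (Lbar * D))
            (nat \<lceil>2 * G / \<epsilon>\<rceil>) (nat \<lceil>G^2 / (8 * \<epsilon>^2)\<rceil>) q T \<Omega> H x v g M0 Mh \<longrightarrow>
          (\<forall>\<omega>\<in>space \<Omega>.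
             real ((\<Sum>i=0..T. length (Mh i \<omega>)) + (\<Sum>k=0..T div q. length (M0 (q * k) \<omega>)))
             \<le> K * (Lbar * G * (objective \<nu> p Ft xstar - objective \<nu> p Ft x0) / \<epsilon>^3)))"
proof -
  \<comment> \<open>The constant 75 is absolute; only the threshold for \<epsilon> depends on the
    problem data, through \<open>G\<close> and the product of \<open>Lbar\<close> with the
    optimality gap.\<close>
  have bound: "\<forall>\<^sub>F \<epsilon> in at_right 0.
        \<forall>T q (\<Omega> :: 'w measure) H x v g M0 Mh.
          T = nat \<lceil>Lbar * (objective \<nu> p Ft xstar - objective \<nu> p Ft x0) / \<epsilon>^2\<rceil> \<longrightarrow>
          q = nat \<lceil>G / (16 * \<epsilon>)\<rceil> \<longrightarrow>
          T mod q = 0 \<longrightarrow>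
          sfwpp_run \<nu> p Ft C x0 (\<lambda>t. \<epsilon> / (Lbar * D))
            (nat \<lceil>2 * G / \<epsilon>\<rceil>) (nat \<lceil>G^2 / (8 * \<epsilon>^2)\<rceil>) q T \<Omega> H x v g M0 Mh \<longrightarrow>
          (\<forall>\<omega>\<in>space \<Omega>.
             real ((\<Sum>i=0..T. length (Mh i \<omega>)) + (\<Sum>k=0..T div q. length (M0 (q * k) \<omega>)))
             \<le> 75 * (Lbar * G * (objective \<nu> p Ft xstar - objective \<nu> p Ft x0) / \<epsilon>^3))"
    if asm: "sfw_assumptions \<nu> p Ft C B D GF Gp LF Lp L2F L2p"
      and G: "G = max GF Gp"
      and Lbar: "Lbar = sqrt (4 * B^2 * G^4 + 16 * G^4 + 4 * L^2 + 4 * B^2 * L^2)"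
      and gap: "objective \<nu> p Ft x0 < objective \<nu> p Ft xstar"
    for \<nu> :: "'z measure" and p and Ft :: "real^'n \<Rightarrow> 'z \<Rightarrow> real"
      and C B D GF Gp LF Lp L2F L2p x0 xstar G L Lbar
  proof (cases "G = 0")
    case True
    show ?thesis
    proof (intro always_eventually allI impI ballI, goal_cases)
      \<comment> \<open>Here \<open>q = 0\<close> as well, so \<open>T div q\<close> has the default
        value 0; both batch sizes vanish, and so do both sides of the bound.\<close>
      case (1 \<epsilon> T q \<Omega> H x v g M0 Mh \<omega>)
      show ?case
        unfolding length_sum_sfwpp_run[OF 1(4,5)] by (simp add: True)
    qed
  next
    case False
    define \<Delta> where "\<Delta> = objective \<nu> p Ft xstar - objective \<nu> p Ft x0"
    have "0 \<le> Gp" using asm by (simp add: sfw_assumptions_def)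
    then have "0 < G" using G False by linarith
    then have "0 < Lbar"
      unfolding Lbar by (intro real_sqrt_gt_zero add_pos_nonneg add_nonneg_pos) auto
    then have A: "0 < Lbar * \<Delta>" using gap by (simp add: \<Delta>_def)
    have "\<forall>\<^sub>F \<epsilon> in at_right (0::real). 0 < \<epsilon>" by (rule eventually_at_right_less)
    \<comment> \<open>The entry 1 in the minimum yields
      \<open>\<epsilon>^2 \<le> \<epsilon>\<close>, which turns the linear bound by
      \<open>Lbar * \<Delta>\<close> into the quadratic one.\<close>
    moreover have "\<forall>\<^sub>F \<epsilon> in at_right 0. \<epsilon> * 1 \<le> min 1 (min G (Lbar * \<Delta>))"
      using \<open>0 < G\<close> A by (intro eventually_at_right_mult_le) simp
    moreover have "\<forall>\<^sub>F \<epsilon> in at_right 0. \<epsilon> * G \<le> Lbar * \<Delta>"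
      using A by (rule eventually_at_right_mult_le)
    ultimately show ?thesis
    proof eventually_elim
      case (elim \<epsilon>)
      have "\<epsilon>^2 \<le> \<epsilon>" using elim by (simp add: power2_eq_square mult_left_le)
      with elim have "\<epsilon>^2 \<le> Lbar * \<Delta>" by simp
      show ?case
      proof (intro allI impI ballI, goal_cases)
        case (1 T q \<Omega> H x v g M0 Mh \<omega>)
        have "real ((T + 1) * nat \<lceil>2 * G / \<epsilon>\<rceil> + (T div q + 1) * nat \<lceil>G^2 / (8 * \<epsilon>^2)\<rceil>)
            \<le> 75 * (Lbar * \<Delta> * G / \<epsilon>^3)"
          using elim \<open>\<epsilon>^2 \<le> Lbar * \<Delta>\<close> 1(1,2) A \<open>0 < G\<close> by (intro sample_count_le) (simp_all add: \<Delta>_def)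
        then show ?case
          unfolding length_sum_sfwpp_run[OF 1(4,5)] by (simp only: \<Delta>_def mult.commute mult.left_commute)
      qed
    qed
  qed
  show ?thesis
  proof (rule exI[of _ 75], intro conjI allI impI, goal_cases)
    case 1
    show ?case by simp
  next
    case (2 \<nu> p Ft X C B D GF Gp LF Lp L2F L2p x0 xstar G L Lbar)
    show ?case by (rule bound[OF 2(2,3,5,8)])
  qed
qed

end
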